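(* For an integer $p\ge 3$ define the real numbers $b_i$, $i\ge1$, by $$b_1=\tfrac14,\quad b_2=\tfrac38,\quad b_{1+l}=\tfrac14\ \text{ for } l\ge 1,\ l\not\equiv 0,1 \ (\mathrm{mod}\ p),$$ $$b_{1+pk}=\tfrac14\,\frac{2k-1}{2k+1},\quad b_{2+pk}=\tfrac14\,\frac{2k+3}{2k+1}\ \text{ for } k\ge1,$$ and let $z_p=\cos^{-2}(\pi/p)=1/\cos^2(\pi/p)>1$. Consider the limit periodic continued fraction $$g_p(z_p)=\frac{1}{1-}\,\frac{b_1z_p}{1-}\,\frac{b_2z_p}{1-}\,\frac{b_3z_p}{1-\cdots},\qquad \lim_{i\to\infty}b_iz_p=\frac{z_p}{4}>\frac14 .$$ If $p$ is odd, then this continued fraction converges (in the classical sense) to $1$. If $p$ is even, then it diverges by oscillation. In particular (case $p=3$, $z_3=4$), the continued fraction $$\frac{1}{1-}\,\frac{1}{1-}\,\frac{3/2}{1-}\,\frac{1}{1-}\,\frac{1/3}{1-}\,\frac{5/3}{1-}\,\frac{1}{1-}\,\frac{3/5}{1-}\,\frac{7/5}{1-}\,\frac{1}{1-\cdots}$$ with partial coefficients $4b_i$ converges to $1$.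
   Context: The notation $\frac{1}{1-}\,\frac{c_1}{1-}\,\frac{c_2}{1-\cdots}$ denotes the continued fraction $1/(1-c_1/(1-c_2/(1-\cdots)))$. Put $h_0(t)=\frac{1}{1+t}$, $h_i(t)=\frac{-c_i}{1+t}$ for $i\ge1$, as Möbius transformations of $\mathbb C_\infty=\mathbb C\cup\{\infty\}$, and $H_n=h_0\circ h_1\circ\cdots\circ h_n$. The continued fraction converges in the classical sense to $\alpha\in\mathbb C_\infty$ if $\lim_{n\to\infty}H_n(0)=\lim_{n\to\infty}H_n(\infty)=\alpha$ in $\mathbb C_\infty$. It diverges by oscillation if the sequence of approximants $H_n(0)$ has no limit in $\mathbb C_\infty$. *)

theory Defs
  imports "HOL-Analysis.Analysis"
begin

(* The Riemann sphere is the one-point compactification of the complex plane: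
   Some z is the finite point z, None is the point at infinity. *)

abbreviation riemann_sphere :: "complex option topology" where
  "riemann_sphere \<equiv> Alexandroff_compactification euclidean"

definition moebius_sphere ::
    "complex \<Rightarrow> complex \<Rightarrow> complex \<Rightarrow> complex \<Rightarrow> complex option \<Rightarrow> complex option" where
  "moebius_sphere a b c d w = (case w of
      None \<Rightarrow> if c = 0 then None else Some (a / c)
    | Some z \<Rightarrow> if c * z + d = 0 then None else Some (moebius a b c d z))"

(* A coefficient sequence c describes 1/(1 - c 1/(1 - c 2/(1 - ...))); c 0 is not used. *)

definition cf_map :: "(nat \<Rightarrow> complex) \<Rightarrow> nat \<Rightarrow> complex option \<Rightarrow> complex option" where
  "cf_map c i = (if i = 0 then moebius_sphere 0 1 1 1 else moebius_sphere 0 (- c i) 1 1)"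

fun cf_comp :: "(nat \<Rightarrow> complex) \<Rightarrow> nat \<Rightarrow> complex option \<Rightarrow> complex option" where
  "cf_comp c 0 = cf_map c 0"
| "cf_comp c (Suc n) = cf_comp c n \<circ> cf_map c (Suc n)"

definition cf_converges_to :: "(nat \<Rightarrow> complex) \<Rightarrow> complex option \<Rightarrow> bool" where
  "cf_converges_to c \<alpha> \<longleftrightarrow>
     limitin riemann_sphere (\<lambda>n. cf_comp c n (Some 0)) \<alpha> sequentially \<and>
     limitin riemann_sphere (\<lambda>n. cf_comp c n None) \<alpha> sequentially"

definition cf_diverges_by_oscillation :: "(nat \<Rightarrow> complex) \<Rightarrow> bool" where
  "cf_diverges_by_oscillation c \<longleftrightarrow>
     \<not> (\<exists>\<alpha>. limitin riemann_sphere (\<lambda>n. cf_comp c n (Some 0)) \<alpha> sequentially)"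

definition b_coeff :: "nat \<Rightarrow> nat \<Rightarrow> real" where
  "b_coeff p i =
    (if i = 1 then 1/4
     else if i = 2 then 3/8
     else let l = i - 1; k = real (l div p) in
       if l mod p = 0 then 1/4 * ((2*k - 1) / (2*k + 1))
       else if l mod p = 1 then 1/4 * ((2*k + 3) / (2*k + 1))
       else 1/4)"

lemma b_coeff_eqs:
  assumes "3 \<le> p"
  shows "b_coeff p 1 = 1/4"
    and "b_coeff p 2 = 3/8"
    and "l mod p \<noteq> 0 \<Longrightarrow> l mod p \<noteq> 1 \<Longrightarrow> b_coeff p (1 + l) = 1/4"
    and "1 \<le> k \<Longrightarrow> b_coeff p (1 + p * k) = 1/4 * ((2 * real k - 1) / (2 * real k + 1))"
    and "1 \<le> k \<Longrightarrow> b_coeff p (2 + p * k) = 1/4 * ((2 * real k + 3) / (2 * real k + 1))"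
proof -
  show "b_coeff p 1 = 1/4" "b_coeff p 2 = 3/8"
    by (simp_all add: b_coeff_def)
  show "b_coeff p (1 + l) = 1/4" if "l mod p \<noteq> 0" "l mod p \<noteq> 1"
  proof -
    have "l \<noteq> 0" "l \<noteq> 1" using that assms by (cases "l = 0"; cases "l = 1"; simp)+
    then show ?thesis using that by (simp add: b_coeff_def Let_def)
  qed
  show "b_coeff p (1 + p * k) = 1/4 * ((2 * real k - 1) / (2 * real k + 1))" if "1 \<le> k"
  proof -
    have "p * k \<noteq> 0" "p * k \<noteq> 1" using that assms by auto
    then show ?thesis using assms by (simp add: b_coeff_def Let_def)
  qed
  show "b_coeff p (2 + p * k) = 1/4 * ((2 * real k + 3) / (2 * real k + 1))" if "1 \<le> k"
  proof -
    have "Suc (p * k) mod p = 1"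
      using assms by (simp add: mod_Suc)
    moreover have "Suc (p * k) div p = k"
      using assms by (intro div_nat_eqI) (auto simp: algebra_simps)
    ultimately show ?thesis using that assms by (simp add: b_coeff_def Let_def)
  qed
qed

definition z_par :: "nat \<Rightarrow> real" where
  "z_par p = 1 / (cos (pi / real p))\<^sup>2"

end

theory Submission
  imports Defs
begin

text \<open>
  Write \<open>c = cos \<theta>\<close> with \<open>\<theta> = \<pi> / p\<close>. Multiplied by \<open>(2 c)\<^sup>n\<close>, the canonical numerators and
  denominators satisfy \<open>x\<^sub>n = 2 c x\<^bsub>n-1\<^esub> - 4 b\<^sub>n x\<^bsub>n-2\<^esub>\<close>. Where \<open>4 b\<^sub>n = 1\<close> this is the recurrence of
  \<open>cos (n \<theta>)\<close> and \<open>sin (n \<theta>)\<close>; the perturbation of the coefficients once in each block of length \<open>p\<close>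
  only changes their amplitudes, which in block \<open>k\<close> are proportional to \<open>2 k + 3\<close> and
  \<open>1 / (2 k + 1)\<close> respectively. Numerators and
  denominators have the same cosine part and differ only in the decaying sine part. So the
  approximants tend to \<open>1\<close> as long as the cosine does not vanish, which is the case for odd \<open>p\<close>;
  for even \<open>p\<close> it vanishes in the middle of each block, and there the approximant
  is \<open>- cot\<^sup>2 \<theta>\<close>.
\<close>

section \<open>Canonical numerators and denominators\<close>

text \<open>
  The index is shifted by one: for \<open>y = 0\<close> and \<open>y = 1\<close>, \<open>cf_cont c y (Suc n)\<close> is the numerator,
  respectively the denominator, of the approximant \<open>cf_comp c n (Some 0)\<close>.
\<close>

fun cf_cont :: "(nat \<Rightarrow> 'a::comm_ring_1) \<Rightarrow> 'a \<Rightarrow> nat \<Rightarrow> 'a" where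
  "cf_cont c y 0 = y"
| "cf_cont c y (Suc 0) = 1"
| "cf_cont c y (Suc (Suc n)) = cf_cont c y (Suc n) - c (Suc n) * cf_cont c y n"

lemma cf_cont_of_real:
  "cf_cont (\<lambda>i. of_real (c i)) (of_real y) n = (of_real (cf_cont c y n) :: 'a::{real_algebra_1,comm_ring_1})"
  by (induction c y n rule: cf_cont.induct) simp_all

text \<open>The point with homogeneous coordinates \<open>a : b\<close>. Sending
  \<open>(0, 0)\<close> to infinity too lets a common nonzero factor cancel for all \<open>a\<close>
  and \<open>b\<close>.\<close>

definition sphere_div :: "complex \<Rightarrow> complex \<Rightarrow> complex option" where
  "sphere_div a b = (if b = 0 then None else Some (a / b))"

lemma sphere_div_mult_cancel: "k \<noteq> 0 \<Longrightarrow> sphere_div (k * a) (k * b) = sphere_div a b"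
  by (simp add: sphere_div_def)

text \<open>Each row of the matrix of the composed Moebius map consists of two consecutive
  continuants. The induction keeps \<open>w\<close> arbitrary because the recursion composes on the
  inside and so replaces \<open>w\<close> by its image.\<close>

lemma cf_comp_eq_sphere_div:
  assumes "\<And>i. i \<ge> 1 \<Longrightarrow> c i \<noteq> 0"
  shows "cf_comp c n w = (case w of
      None \<Rightarrow> sphere_div (cf_cont c 0 n) (cf_cont c 1 n)
    | Some t \<Rightarrow> sphere_div (cf_cont c 0 (Suc n) + t * cf_cont c 0 n)
                           (cf_cont c 1 (Suc n) + t * cf_cont c 1 n))"
proof (induction n arbitrary: w)
  case 0
  show ?case
    by (auto simp: cf_map_def moebius_sphere_def sphere_div_def moebius_def add.commute split: option.split)
next
  case (Suc n)
  let ?P = "cf_cont c 0" and ?Q = "cf_cont c 1"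
  have c: "c (Suc n) \<noteq> 0" using assms by simp
  show ?case
  proof (cases w)
    case None
    then show ?thesis using Suc
      by (simp add: cf_map_def moebius_sphere_def)
  next
    case (Some t)
    show ?thesis
    proof (cases "1 + t = 0")
      case True
      then have t: "t = -1" by (simp add: eq_neg_iff_add_eq_0 add.commute)
      \<comment> \<open>At \<open>t = -1\<close> the new map has its pole. The recurrence then
        leaves only this multiple of the older continuants.\<close>
      have "sphere_div (- c (Suc n) * ?P n) (- c (Suc n) * ?Q n) = sphere_div (?P n) (?Q n)"
        using c by (intro sphere_div_mult_cancel) simp
      then show ?thesis using Suc t Some
        by (simp add: cf_map_def moebius_sphere_def)
    next
      case False
      let ?u = "- c (Suc n) / (1 + t)"
      have lin: "(1 + t) * (cf_cont c y (Suc n) + ?u * cf_cont c y n) =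
          cf_cont c y (Suc (Suc n)) + t * cf_cont c y (Suc n)" for y
        using False by (simp add: field_simps)
      have "cf_comp c (Suc n) w = cf_comp c n (Some ?u)"
        using False Some by (simp add: cf_map_def moebius_sphere_def moebius_def add.commute)
      also have "\<dots> = sphere_div (?P (Suc n) + ?u * ?P n) (?Q (Suc n) + ?u * ?Q n)"
        using Suc by simp
      also have "\<dots> = sphere_div (?P (Suc (Suc n)) + t * ?P (Suc n)) (?Q (Suc (Suc n)) + t * ?Q (Suc n))"
        using sphere_div_mult_cancel[OF False, of "?P (Suc n) + ?u * ?P n" "?Q (Suc n) + ?u * ?Q n"]
        unfolding lin by simp
      finally show ?thesis using Some by simp
    qed
  qed
qed

lemma cf_comp_real_zero:
  fixes a :: "nat \<Rightarrow> real"
  assumes "\<And>i. i \<ge> 1 \<Longrightarrow> a i \<noteq> 0"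
  shows "cf_comp (\<lambda>i. of_real (a i)) n (Some 0) =
    (if cf_cont a 1 (Suc n) = 0 then None
     else Some (of_real (cf_cont a 0 (Suc n) / cf_cont a 1 (Suc n))))"
proof -
  let ?c = "\<lambda>i. complex_of_real (a i)"
  have "cf_comp ?c n (Some 0) = sphere_div (cf_cont ?c 0 (Suc n)) (cf_cont ?c 1 (Suc n))"
    using assms by (subst cf_comp_eq_sphere_div) auto
  then show ?thesis
    using cf_cont_of_real[of a 0 "Suc n", where 'a=complex]
      cf_cont_of_real[of a 1 "Suc n", where 'a=complex]
    by (simp add: sphere_div_def)
qed

text \<open>Every \<open>cf_map\<close> sends infinity to 0, so the values at infinity are the
  approximants delayed by one index. Classical convergence thus reduces to the approximants
  alone.\<close>

lemma cf_comp_Suc_None: "cf_comp c (Suc n) None = cf_comp c n (Some 0)"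
  by (simp add: cf_map_def moebius_sphere_def)

section \<open>Limits on the Riemann sphere\<close>

lemma limitin_sphere_Some:
  assumes "(f \<longlongrightarrow> l) F" "\<forall>\<^sub>F x in F. g x = Some (f x)"
  shows "limitin riemann_sphere g (Some l) F"
proof -
  have "limitin riemann_sphere (Some \<circ> f) (Some l) F"
    using assms(1) by (intro continuous_map_limit[OF continuous_map_Some]) simp
  moreover have "\<forall>\<^sub>F x in F. (Some \<circ> f) x = g x"
    using assms(2) by eventually_elim simp
  ultimately show ?thesis
    by (rule limitin_transform_eventually[rotated])
qed

lemma cf_converges_toI:
  assumes "limitin riemann_sphere (\<lambda>n. cf_comp c n (Some 0)) \<alpha> sequentially"
  shows "cf_converges_to c \<alpha>"
  using assms limitin_sequentially_offset_rev[of riemann_sphere "\<lambda>n. cf_comp c n None" 1 \<alpha>]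
  by (simp add: cf_converges_to_def cf_comp_Suc_None del: cf_comp.simps)

lemma Hausdorff_riemann_sphere: "Hausdorff_space riemann_sphere"
  by (simp add: Hausdorff_space_Alexandroff_compactification Hausdorff_space_euclidean
      locally_compact_space_euclidean)

text \<open>Limits in the Hausdorff sphere are unique, so a limit would have to equal the value of
  each of the two constant subsequences.\<close>

lemma cf_diverges_by_oscillationI:
  fixes r s :: "nat \<Rightarrow> nat"
  assumes "strict_mono r" "strict_mono s" "u \<noteq> v"
    and "\<And>k. cf_comp c (r k) (Some 0) = Some u" "\<And>k. cf_comp c (s k) (Some 0) = Some v"
  shows "cf_diverges_by_oscillation c"
  unfolding cf_diverges_by_oscillation_def
proof
  assume "\<exists>\<alpha>. limitin riemann_sphere (\<lambda>n. cf_comp c n (Some 0)) \<alpha> sequentially"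
  then obtain \<alpha> where \<alpha>: "limitin riemann_sphere (\<lambda>n. cf_comp c n (Some 0)) \<alpha> sequentially" ..
  have unique: "\<alpha> = Some w"
    if "strict_mono q" "\<And>k. cf_comp c (q k) (Some 0) = Some w" for q :: "nat \<Rightarrow> nat" and w
  proof (rule limitin_Hausdorff_unique[OF _ _ _ Hausdorff_riemann_sphere])
    show "limitin riemann_sphere (\<lambda>k. cf_comp c (q k) (Some 0)) \<alpha> sequentially"
      using limitin_subsequence[OF that(1) \<alpha>] by (simp add: o_def)
    show "limitin riemann_sphere (\<lambda>k. cf_comp c (q k) (Some 0)) (Some w) sequentially"
      using that(2) by (intro limitin_sphere_Some[of "\<lambda>_. w"]) simp_all
  qed simp
  show False using unique[of r u] unique[of s v] assms by simp
qed

section \<open>The coefficients\<close>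

lemma b_coeff_pos: "i \<ge> 1 \<Longrightarrow> b_coeff p i > 0"
proof -
  assume i: "i \<ge> 1"
  \<comment> \<open>Only the factor \<open>2*k - 1\<close> could be negative, namely at
    \<open>k = 0\<close>. Residue 0 with \<open>i \<noteq> 1\<close> rules that out.\<close>
  have "real ((i - 1) div p) \<ge> 1" if "(i - 1) mod p = 0" "i \<noteq> 1"
  proof -
    have "(i - 1) div p \<noteq> 0"
      using that i div_mult_mod_eq[of "i - 1" p]
      by (metis One_nat_def Suc_pred add_0 le_simps(3) mult_zero_left)
    then show ?thesis by simp
  qed
  then show ?thesis by (auto simp: b_coeff_def Let_def)
qed

lemma b_coeff_bound: "i \<ge> 1 \<Longrightarrow> \<bar>b_coeff p i - 1/4\<bar> \<le> 1 / (2 * real ((i - 1) div p) + 1)"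
proof -
  have *: "1/4 * ((2*x - 1) / (2*x + 1)) - 1/4 = - ((1/2) / (2*x+1))"
    "1/4 * ((2*x + 3) / (2*x + 1)) - 1/4 = (1/2) / (2*x+1)" if "x \<ge> 0" for x :: real
    using that by (simp_all add: field_simps)
  assume "i \<ge> 1"
  show ?thesis
  proof (cases "i = 2")
    case True
    have "1 div p \<le> 1" using div_le_dividend by blast
    \<comment> \<open>The exceptional value 3/8 is off by 1/8, and
      \<open>1/8 \<le> 1 / (2*x + 1)\<close> means \<open>2*x \<le> 7\<close>.\<close>
    then have "2 * real (1 div p) \<le> 7" by linarith
    then show ?thesis using True by (simp add: b_coeff_def field_simps)
  next
    case False
    define x where "x = real ((i - 1) div p)"
    have x: "x \<ge> 0" by (simp add: x_def)
    have "b_coeff p i - 1/4 = 0 \<or> b_coeff p i - 1/4 = 1/4 * ((2*x - 1) / (2*x + 1)) - 1/4 \<or>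
        b_coeff p i - 1/4 = 1/4 * ((2*x + 3) / (2*x + 1)) - 1/4"
      using False by (simp add: b_coeff_def Let_def x_def)
    moreover have "\<bar>(1/2) / (2 * x + 1)\<bar> \<le> 1 / (2 * x + 1)" "0 \<le> 1 / (2 * x + 1)"
      using x by (simp_all add: abs_divide frac_le)
    ultimately have "\<bar>b_coeff p i - 1/4\<bar> \<le> 1 / (2 * x + 1)"
      unfolding *[OF x] by (elim disjE) (simp_all only: abs_minus_cancel abs_zero)
    then show ?thesis by (simp add: x_def)
  qed
qed

lemma filterlim_div_at_top: "p > 0 \<Longrightarrow> filterlim (\<lambda>n. n div p) at_top (at_top :: nat filter)"
proof (rule filterlim_at_top[THEN iffD2], rule allI)
  fix Z :: nat assume "p > 0"
  then show "\<forall>\<^sub>F n in at_top. Z \<le> n div p"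
    by (intro eventually_at_top_linorderI[of "Z * p"]) (simp add: less_eq_div_iff_mult_less_eq)
qed

lemma b_coeff_tendsto:
  assumes "p > 0"
  shows "b_coeff p \<longlonglongrightarrow> 1/4"
proof -
  have "(\<lambda>k. 1 / (2 * real k + 1)) \<longlonglongrightarrow> 0"
    using LIMSEQ_subseq_LIMSEQ[OF LIMSEQ_inverse_real_of_nat, of "\<lambda>k. 2 * k"]
    by (simp add: o_def strict_mono_def inverse_eq_divide add.commute)
  then have "(\<lambda>i. 1 / (2 * real (i div p) + 1)) \<longlonglongrightarrow> 0"
    by (rule filterlim_compose[OF _ filterlim_div_at_top[OF assms]])
  then have "(\<lambda>i. b_coeff p (Suc i) - 1/4) \<longlonglongrightarrow> 0"
    by (rule Lim_null_comparison[rotated]) (use b_coeff_bound[of "Suc _" p] in simp)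
  then have "(\<lambda>i. b_coeff p (Suc i)) \<longlonglongrightarrow> 1/4"
    by (simp add: LIM_zero_iff)
  then show ?thesis by (rule LIMSEQ_imp_Suc)
qed

section \<open>Explicit solution of the recurrence\<close>

context
  fixes p :: nat
  assumes p: "3 \<le> p"
begin

abbreviation (input) "\<theta> \<equiv> pi / real p"

abbreviation (input) "bz \<equiv> \<lambda>i. b_coeff p i * z_par p"

lemma theta_bounds: "0 < \<theta>" "\<theta> < pi / 2"
  using p by (auto simp: field_simps)

lemma cos_theta_pos: "cos \<theta> > 0"
  using theta_bounds by (intro cos_gt_zero) auto

lemma sin_theta_pos: "sin \<theta> > 0"
  using theta_bounds by (intro sin_gt_zero2) auto

lemma cos_theta_sq_less_1: "(cos \<theta>)\<^sup>2 < 1"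
  using sin_theta_pos sin_cos_squared_add[of \<theta>] by (smt (verit) zero_less_power)

lemma bz_nonzero: "i \<ge> 1 \<Longrightarrow> bz i \<noteq> 0"
  using b_coeff_pos[of i p] cos_theta_pos by (simp add: z_par_def)

text \<open>The shift in \<open>cf_cont\<close> is undone: index \<open>n\<close> belongs to the
  approximant \<open>cf_comp c n (Some 0)\<close>.\<close>

definition scaled :: "real \<Rightarrow> nat \<Rightarrow> real" where
  "scaled y n = (2 * cos \<theta>) ^ n * cf_cont bz y (Suc n)"

text \<open>The value forced by \<open>scaled y 1 = closed_form y 0 1\<close>.\<close>

definition sine_weight :: "real \<Rightarrow> real" where
  "sine_weight y = y / (2 * cos \<theta>) - cos \<theta> / 2"

text \<open>The value at position \<open>j\<close> of block \<open>k\<close>. The angle grows by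
  \<pi> over a block; the sign \<open>(-1) ^ k\<close> accounts for this, so the angle restarts from
  0.\<close>

definition closed_form :: "real \<Rightarrow> nat \<Rightarrow> nat \<Rightarrow> real" where
  "closed_form y k j = (-1) ^ k *
     ((2 * real k + 3) / 2 * cos (real j * \<theta>) -
      sine_weight y / (2 * real k + 1) * (sin (real j * \<theta>) / sin \<theta>))"

lemma scaled_rec: "scaled y (Suc (Suc n)) =
    2 * cos \<theta> * scaled y (Suc n) - 4 * b_coeff p (Suc (Suc n)) * scaled y n"
  using cos_theta_pos by (simp add: scaled_def z_par_def field_simps power2_eq_square)

text \<open>Expanding both neighbours around the middle angle, the sum of the two outer cosines (or
  sines) is \<open>2 * cos \<theta>\<close> times the middle one.\<close>

lemma closed_form_rec:
  "closed_form y k (Suc (Suc j)) = 2 * cos \<theta> * closed_form y k (Suc j) - closed_form y k j"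
proof -
  have eq: "real (Suc (Suc j)) * \<theta> = real (Suc j) * \<theta> + \<theta>" "real j * \<theta> = real (Suc j) * \<theta> - \<theta>"
    by (simp_all add: ring_distribs add_divide_distrib)
  show ?thesis
    unfolding closed_form_def eq
    by (simp only: cos_add cos_diff sin_add sin_diff)
      (simp add: algebra_simps add_divide_distrib diff_divide_distrib)
qed

lemma cos_sin_2_theta: "cos (2 * \<theta>) = 2 * (cos \<theta>)\<^sup>2 - 1" "sin (2 * \<theta>) / sin \<theta> = 2 * cos \<theta>"
  using sin_theta_pos by (simp_all only: cos_double_cos sin_double) simp_all

lemma closed_form_base:
  "closed_form y k 1 = (-1) ^ k * ((2 * real k + 3) / 2 * cos \<theta> - sine_weight y / (2 * real k + 1))"
  "closed_form y k 2 = (-1) ^ k * ((2 * real k + 3) / 2 * (2 * (cos \<theta>)\<^sup>2 - 1)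
     - sine_weight y / (2 * real k + 1) * (2 * cos \<theta>))"
  using sin_theta_pos cos_sin_2_theta by (simp_all add: closed_form_def)

lemma closed_form_end:
  "closed_form y k p = - ((-1) ^ k * ((2 * real k + 3) / 2))"
  "closed_form y k (p - 1) =
     - ((-1) ^ k * ((2 * real k + 3) / 2 * cos \<theta> + sine_weight y / (2 * real k + 1)))"
proof -
  have angle: "real p * \<theta> = pi" "real (p - 1) * \<theta> = pi - \<theta>"
    using p by (simp_all add: of_nat_diff field_simps)
  then show "closed_form y k p = - ((-1) ^ k * ((2 * real k + 3) / 2))"
    "closed_form y k (p - 1) =
     - ((-1) ^ k * ((2 * real k + 3) / 2 * cos \<theta> + sine_weight y / (2 * real k + 1)))"
    using sin_theta_pos unfolding closed_form_def angle
    by (simp_all add: right_diff_distrib distrib_left)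
qed

text \<open>The two perturbed coefficients are exactly those that carry the amplitudes from block
  \<open>k\<close> to block \<open>Suc k\<close>.\<close>

lemma closed_form_step:
  "closed_form y (Suc k) 1 = 2 * cos \<theta> * closed_form y k p
     - (2 * real (Suc k) - 1) / (2 * real (Suc k) + 1) * closed_form y k (p - 1)" (is ?A)
  "closed_form y (Suc k) 2 = 2 * cos \<theta> * closed_form y (Suc k) 1
     - (2 * real (Suc k) + 3) / (2 * real (Suc k) + 1) * closed_form y k p" (is ?B)
proof -
  \<comment> \<open>The letters stand for \<open>s = (-1) ^ k\<close>,
    \<open>c = cos \<theta>\<close>, \<open>d = sine_weight y\<close> and
    \<open>x = real k\<close>.\<close>
  have alg: "- s * ((2 * (x + 1) + 3) / 2 * c - d / (2 * (x + 1) + 1)) =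
      2 * c * - (s * ((2 * x + 3) / 2))
      - (2 * (x + 1) - 1) / (2 * (x + 1) + 1) * - (s * ((2 * x + 3) / 2 * c + d / (2 * x + 1)))"
    "- s * ((2 * (x + 1) + 3) / 2 * (2 * c\<^sup>2 - 1) - d / (2 * (x + 1) + 1) * (2 * c)) =
      2 * c * (- s * ((2 * (x + 1) + 3) / 2 * c - d / (2 * (x + 1) + 1)))
      - (2 * (x + 1) + 3) / (2 * (x + 1) + 1) * - (s * ((2 * x + 3) / 2))"
    if "x \<ge> 0" for s c d x :: real
  proof -
    have nz: "2 * x + 1 \<noteq> 0" "2 * x + 3 \<noteq> 0" using that by auto
    have e: "2 * (x + 1) + 1 = 2 * x + 3" "2 * (x + 1) - 1 = 2 * x + 1" by auto
    \<comment> \<open>The first coefficient already gives the sine part its new denominator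
      \<open>2 * x + 3\<close>; the cosine amplitude is completed by the term
      \<open>2 * c * closed_form y k p\<close>.\<close>
    have q: "(2 * x + 1) / (2 * x + 3) * - (s * ((2 * x + 3) / 2 * c + d / (2 * x + 1)))
       = - s * ((2 * x + 1) / 2 * c + d / (2 * x + 3))"
      using nz by (simp add: divide_simps) (simp add: algebra_simps)
    have q': "(2 * (x + 1) + 3) / (2 * x + 3) * - (s * ((2 * x + 3) / 2)) = - s * ((2 * (x + 1) + 3) / 2)"
      using nz by (simp add: divide_simps)
    show "- s * ((2 * (x + 1) + 3) / 2 * c - d / (2 * (x + 1) + 1)) =
      2 * c * - (s * ((2 * x + 3) / 2))
      - (2 * (x + 1) - 1) / (2 * (x + 1) + 1) * - (s * ((2 * x + 3) / 2 * c + d / (2 * x + 1)))"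
      unfolding e q by (simp add: algebra_simps add_divide_distrib)
    show "- s * ((2 * (x + 1) + 3) / 2 * (2 * c\<^sup>2 - 1) - d / (2 * (x + 1) + 1) * (2 * c)) =
      2 * c * (- s * ((2 * (x + 1) + 3) / 2 * c - d / (2 * (x + 1) + 1)))
      - (2 * (x + 1) + 3) / (2 * (x + 1) + 1) * - (s * ((2 * x + 3) / 2))"
      unfolding e q' by (simp add: algebra_simps add_divide_distrib power2_eq_square)
  qed
  have k: "real (Suc k) = real k + 1" "(-1) ^ Suc k = - ((-1) ^ k :: real)" by simp_all
  show ?A unfolding closed_form_base closed_form_end k by (rule alg) simp
  show ?B unfolding closed_form_base closed_form_end k by (rule alg) simp
qed

text \<open>Induction over blocks, with an inner induction over positions. Position 0 is excluded:
  the new cosine amplitude is not yet in force there (for \<open>k = 0\<close>,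
  \<open>scaled\<close> is 1 but the formula gives 3/2).\<close>

lemma scaled_eq_closed_form:
  assumes "1 \<le> j" "j \<le> p"
  shows "scaled y (p * k + j) = closed_form y k j"
proof -
  \<comment> \<open>The first two values determine the block, since at positions 3 to
    \<open>p\<close> the coefficient is 1/4 and \<open>closed_form_rec\<close> applies.\<close>
  have block: "scaled y (p * k + Suc j) = closed_form y k (Suc j) \<and>
      scaled y (p * k + Suc (Suc j)) = closed_form y k (Suc (Suc j))"
    if "scaled y (p * k + 1) = closed_form y k 1" "scaled y (p * k + 2) = closed_form y k 2"
      "j + 2 \<le> p" for k j
    using that(3)
  proof (induction j)
    case 0
    then show ?case using that by (simp add: numeral_2_eq_2)
  next
    case (Suc j)
    have "(p * k + Suc (Suc j)) mod p = Suc (Suc j)"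
      using Suc.prems by (simp only: mod_mult_self4 mod_less)
    then have "b_coeff p (1 + (p * k + Suc (Suc j))) = 1/4"
      by (intro b_coeff_eqs(3)[OF p]) simp_all
    then have "scaled y (p * k + Suc (Suc (Suc j))) =
        2 * cos \<theta> * scaled y (p * k + Suc (Suc j)) - scaled y (p * k + Suc j)"
      using scaled_rec[of y "p * k + Suc j"] by simp
    then show ?case using Suc closed_form_rec[of y k "Suc j"] by simp
  qed
  have start: "scaled y (p * k + 1) = closed_form y k 1 \<and> scaled y (p * k + 2) = closed_form y k 2" for k
  proof (induction k)
    case 0
    have s0: "scaled y 0 = 1" by (simp add: scaled_def)
    have s1: "scaled y 1 = 2 * cos \<theta> - y / (2 * cos \<theta>)"
      using cos_theta_pos b_coeff_eqs(1)[OF p]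
      by (simp add: scaled_def z_par_def power2_eq_square field_simps)
    have s2: "scaled y 2 = 2 * cos \<theta> * scaled y 1 - 3/2"
      using scaled_rec[of y 0] b_coeff_eqs(2)[OF p] s0 by (simp add: numeral_2_eq_2)
    have "scaled y 1 = closed_form y 0 1" "scaled y 2 = closed_form y 0 2"
      unfolding s2 s1 closed_form_base using cos_theta_pos
      by (simp_all add: sine_weight_def field_simps power2_eq_square)
    then show ?case by (simp only: mult_0_right add_0)
  next
    case (Suc k)
    \<comment> \<open>The last two positions of block \<open>k\<close> are the initial data for the
      two perturbed steps.\<close>
    have "scaled y (p * k + Suc (p - 2)) = closed_form y k (Suc (p - 2)) \<and>
      scaled y (p * k + Suc (Suc (p - 2))) = closed_form y k (Suc (Suc (p - 2)))"
      using Suc p by (intro block) auto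
    moreover have "Suc (Suc (p - 2)) = p" "Suc (p - 2) = p - 1" using p by auto
    ultimately have e: "scaled y (p * k + (p - 1)) = closed_form y k (p - 1)"
      "scaled y (p * k + p) = closed_form y k p" by simp_all
    have i: "Suc (p * k + (p - 1)) = p * k + p" "Suc (p * k + p) = 1 + p * Suc k"
      "Suc (1 + p * Suc k) = 2 + p * Suc k"
      using p by auto
    have k: "1 \<le> Suc k" and quarter: "4 * (1/4 * x) = x" for x :: real by simp_all
    have b: "4 * b_coeff p (1 + p * Suc k) = (2 * real (Suc k) - 1) / (2 * real (Suc k) + 1)"
      "4 * b_coeff p (2 + p * Suc k) = (2 * real (Suc k) + 3) / (2 * real (Suc k) + 1)"
      by (simp_all only: b_coeff_eqs(4,5)[OF p k] quarter)
    have 1: "scaled y (1 + p * Suc k) = closed_form y (Suc k) 1"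
      using scaled_rec[of y "p * k + (p - 1)"] unfolding i b e closed_form_step(1) .
    have 2: "scaled y (2 + p * Suc k) = closed_form y (Suc k) 2"
      using scaled_rec[of y "p * k + p"] unfolding i b e 1 closed_form_step(2) .
    show ?case using 1 2 by (simp only: add.commute)
  qed
  show ?thesis
  proof (cases "j = 1")
    case True
    then show ?thesis using start by simp
  next
    case False
    then show ?thesis using block[of k "j - 2"] start assms
      by (simp add: numeral_2_eq_2 Suc_diff_Suc)
  qed
qed

section \<open>Estimates for numerators and denominators\<close>

lemma cf_comp_bz_zero:
  "cf_comp (\<lambda>i. of_real (bz i)) n (Some 0) =
    (if scaled 1 n = 0 then None else Some (of_real (scaled 0 n / scaled 1 n)))"
  using bz_nonzero cos_theta_pos by (subst cf_comp_real_zero) (auto simp: scaled_def)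

text \<open>The cosine parts cancel and the sine weights differ by
  \<open>1 / (2 * cos \<theta>)\<close>. A bound uniform in \<open>k\<close> suffices because the
  denominators will grow.\<close>

lemma scaled_diff_bound:
  assumes "1 \<le> j" "j \<le> p"
  shows "\<bar>scaled 0 (p * k + j) - scaled 1 (p * k + j)\<bar> \<le> 1 / (2 * cos \<theta> * sin \<theta>)"
proof -
  have "scaled 0 (p * k + j) - scaled 1 (p * k + j) =
      (-1) ^ k * (1 / (2 * real k + 1) * (1 / (2 * cos \<theta> * sin \<theta>)) * sin (real j * \<theta>))"
  proof -
    have "s * (a - (0 / u - v) / n * (x / w)) - s * (a - (1 / u - v) / n * (x / w)) =
        s * (1 / n * (1 / (u * w)) * x)"
      for s a u v n x w :: real
      by (simp add: algebra_simps diff_divide_distrib)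
    then show ?thesis
      unfolding scaled_eq_closed_form[OF assms] closed_form_def sine_weight_def .
  qed
  also have "\<bar>\<dots>\<bar> = 1 / (2 * real k + 1) * \<bar>sin (real j * \<theta>)\<bar> * (1 / (2 * cos \<theta> * sin \<theta>))"
    using cos_theta_pos sin_theta_pos by (simp add: abs_mult power_abs)
  also have "\<dots> \<le> 1 * 1 * (1 / (2 * cos \<theta> * sin \<theta>))"
    using cos_theta_pos sin_theta_pos by (intro mult_right_mono mult_mono) auto
  finally show ?thesis by simp
qed

text \<open>Reverse triangle inequality: the cosine amplitude is at least \<open>k\<close>, while
  the sine part stays bounded.\<close>

lemma scaled_1_lower_bound:
  assumes "1 \<le> j" "j \<le> p"
  shows "\<bar>scaled 1 (p * k + j)\<bar> \<ge> real k * \<bar>cos (real j * \<theta>)\<bar> - \<bar>sine_weight 1\<bar> / sin \<theta>"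
proof -
  let ?A = "(2 * real k + 3) / 2 * cos (real j * \<theta>)"
  let ?B = "sine_weight 1 / (2 * real k + 1) * (sin (real j * \<theta>) / sin \<theta>)"
  have "\<bar>?B\<bar> = 1 / (2 * real k + 1) * \<bar>sin (real j * \<theta>)\<bar> * (\<bar>sine_weight 1\<bar> / sin \<theta>)"
    using sin_theta_pos by (simp add: abs_mult)
  also have "\<dots> \<le> 1 * 1 * (\<bar>sine_weight 1\<bar> / sin \<theta>)"
    using sin_theta_pos by (intro mult_right_mono mult_mono) auto
  finally have B: "\<bar>?B\<bar> \<le> \<bar>sine_weight 1\<bar> / sin \<theta>" by simp
  have "real k * \<bar>cos (real j * \<theta>)\<bar> \<le> \<bar>?A\<bar>"
    unfolding abs_mult by (rule mult_right_mono) simp_all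
  with B have "real k * \<bar>cos (real j * \<theta>)\<bar> - \<bar>sine_weight 1\<bar> / sin \<theta> \<le> \<bar>?A - ?B\<bar>" by linarith
  also have "\<dots> = \<bar>scaled 1 (p * k + j)\<bar>"
    using assms by (simp add: scaled_eq_closed_form closed_form_def abs_mult power_abs)
  finally show ?thesis .
qed

section \<open>Odd \<open>p\<close>: convergence to 1\<close>

lemma cos_multiple_nonzero:
  assumes "odd p"
  shows "cos (real j * \<theta>) \<noteq> 0"
proof
  assume "cos (real j * \<theta>) = 0"
  \<comment> \<open>A zero forces an odd multiple of \<pi>/2, hence \<open>2 * j = i * p\<close>
    with \<open>i\<close> and \<open>p\<close> both odd.\<close>
  then obtain i where i: "odd i" "real j * \<theta> = of_int i * (pi / 2)"
    by (auto simp: cos_zero_iff_int)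
  then have "of_int (2 * int j) = (of_int (i * int p) :: real)"
    using p by (simp add: field_simps)
  then have "2 * int j = i * int p" by (simp only: of_int_eq_iff)
  then have "even (i * int p)" by (metis dvd_triv_left)
  then show False using i(1) assms by simp
qed

lemma odd_converges:
  assumes "odd p"
  shows "cf_converges_to (\<lambda>i. of_real (bz i)) (Some 1)"
proof (rule cf_converges_toI)
  \<comment> \<open>Only finitely many angles occur in a block, so the nonzero cosines have a common
    positive lower bound, and \<open>L\<close> bounds all denominators from below.\<close>
  define m where "m = Min ((\<lambda>j. \<bar>cos (real j * \<theta>)\<bar>) ` {1..p})"
  define C where "C = \<bar>sine_weight 1\<bar> / sin \<theta>"
  define D where "D = 1 / (2 * cos \<theta> * sin \<theta>)"
  define L where "L = (\<lambda>n. m * real (n div p) - C)"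
  have m_pos: "m > 0"
    unfolding m_def using p cos_multiple_nonzero[OF assms] by (subst Min_gr_iff) auto
  have L_top: "filterlim L at_top sequentially"
  proof -
    have "filterlim (\<lambda>n. real (n div p)) at_top sequentially"
      by (rule filterlim_compose[OF filterlim_real_sequentially filterlim_div_at_top]) (use p in simp)
    then have "filterlim (\<lambda>n. - C + m * real (n div p)) at_top sequentially"
      by (intro filterlim_tendsto_add_at_top[OF tendsto_const]
          filterlim_tendsto_pos_mult_at_top[OF tendsto_const m_pos])
    then show ?thesis by (simp add: L_def)
  qed
  have bounds: "\<bar>scaled 0 (Suc n) - scaled 1 (Suc n)\<bar> \<le> D" "\<bar>scaled 1 (Suc n)\<bar> \<ge> L n" for n
  proof -
    \<comment> \<open>Positions run from 1 to \<open>p\<close>, so the remainder is taken of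
      \<open>n\<close> and then shifted to locate \<open>Suc n\<close>.\<close>
    define j where "j = Suc (n mod p)"
    have j: "1 \<le> j" "j \<le> p" using p by (auto simp: j_def Suc_le_eq)
    have n: "Suc n = p * (n div p) + j" by (simp add: j_def)
    show "\<bar>scaled 0 (Suc n) - scaled 1 (Suc n)\<bar> \<le> D"
      unfolding n D_def by (rule scaled_diff_bound[OF j])
    have "m \<le> \<bar>cos (real j * \<theta>)\<bar>"
      unfolding m_def using j by (intro Min_le) auto
    then have "m * real (n div p) \<le> real (n div p) * \<bar>cos (real j * \<theta>)\<bar>"
      by (subst mult.commute) (rule mult_left_mono, simp_all)
    then show "\<bar>scaled 1 (Suc n)\<bar> \<ge> L n"
      using scaled_1_lower_bound[OF j, of "n div p"] unfolding n L_def C_def by linarith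
  qed
  have L_pos: "\<forall>\<^sub>F n in sequentially. L n > 0"
    using L_top by (rule filterlim_at_top_dense[THEN iffD1, rule_format])
  have "(\<lambda>n. D / L n) \<longlonglongrightarrow> 0"
    by (rule real_tendsto_divide_at_top[OF tendsto_const L_top])
  moreover have "\<forall>\<^sub>F n in sequentially. norm (scaled 0 (Suc n) / scaled 1 (Suc n) - 1) \<le> D / L n"
    using L_pos
  proof eventually_elim
    case (elim n)
    then have "scaled 1 (Suc n) \<noteq> 0" using bounds(2)[of n] by auto
    then have "norm (scaled 0 (Suc n) / scaled 1 (Suc n) - 1)
        = \<bar>scaled 0 (Suc n) - scaled 1 (Suc n)\<bar> / \<bar>scaled 1 (Suc n)\<bar>"
      by (simp add: diff_divide_distrib flip: abs_divide)
    also have "\<dots> \<le> D / L n"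
      using elim bounds[of n] by (intro frac_le) auto
    finally show ?case .
  qed
  ultimately have "(\<lambda>n. scaled 0 (Suc n) / scaled 1 (Suc n) - 1) \<longlonglongrightarrow> 0"
    by (rule Lim_null_comparison[rotated])
  then have "(\<lambda>n. scaled 0 (Suc n) / scaled 1 (Suc n)) \<longlonglongrightarrow> 1"
    by (simp add: LIM_zero_iff)
  then have "(\<lambda>n. complex_of_real (scaled 0 (Suc n) / scaled 1 (Suc n))) \<longlonglongrightarrow> 1"
    using tendsto_of_real[where 'a = complex] by fastforce
  moreover have "\<forall>\<^sub>F n in sequentially. cf_comp (\<lambda>i. of_real (bz i)) (Suc n) (Some 0) =
      Some (complex_of_real (scaled 0 (Suc n) / scaled 1 (Suc n)))"
    using L_pos
  proof eventually_elim
    case (elim n)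
    then have "scaled 1 (Suc n) \<noteq> 0" using bounds(2)[of n] by auto
    then show ?case by (simp only: cf_comp_bz_zero if_False)
  qed
  ultimately have "limitin riemann_sphere
      (\<lambda>n. cf_comp (\<lambda>i. of_real (bz i)) (Suc n) (Some 0)) (Some 1) sequentially"
    by (rule limitin_sphere_Some)
  then show "limitin riemann_sphere
      (\<lambda>n. cf_comp (\<lambda>i. of_real (bz i)) n (Some 0)) (Some 1) sequentially"
    using limitin_sequentially_offset_rev[of _ _ 1] by (simp del: cf_comp.simps)
qed

section \<open>Even \<open>p\<close>: oscillation\<close>

lemma even_diverges:
  assumes "even p"
  shows "cf_diverges_by_oscillation (\<lambda>i. of_real (bz i))"
proof (rule cf_diverges_by_oscillationI)
  define h where "h = p div 2"
  have h: "1 \<le> h" "h \<le> p" using p by (auto simp: h_def)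
  have "real h * \<theta> = pi / 2"
    using assms p by (simp add: h_def real_of_nat_div)
  \<comment> \<open>At angle \<pi>/2 only the sine part survives, so the approximant is the ratio of
    the sine weights in every block.\<close>
  then have mid: "closed_form y k h =
      - ((-1) ^ k * (sine_weight y / (2 * real k + 1) * (1 / sin \<theta>)))" for y k
    by (simp only: closed_form_def cos_pi_half sin_pi_half) simp
  show "strict_mono (\<lambda>k. p * k + p)" "strict_mono (\<lambda>k. p * k + h)"
    using p by (auto simp: strict_mono_def)
  \<comment> \<open>At angle \<pi> the sine part vanishes, so numerator and denominator
    coincide.\<close>
  show "cf_comp (\<lambda>i. of_real (bz i)) (p * k + p) (Some 0) = Some 1" for k
  proof -
    have "2 * real k + 3 \<noteq> 0" by linarith
    then have "scaled y (p * k + p) = - ((-1) ^ k * ((2 * real k + 3) / 2))"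
      "(-1) ^ k * ((2 * real k + 3) / 2) \<noteq> 0" for y
      using p by (simp_all add: scaled_eq_closed_form closed_form_end)
    then show ?thesis
      by (simp only: cf_comp_bz_zero neg_equal_0_iff_equal divide_self if_False) simp
  qed
  have nz: "sine_weight 1 > 0"
    using cos_theta_pos cos_theta_sq_less_1
    by (simp add: sine_weight_def field_simps power2_eq_square)
  \<comment> \<open>Opposite signs of the weights already separate their ratio from 1.\<close>
  have "sine_weight 0 < 0" using cos_theta_pos by (simp add: sine_weight_def)
  with nz have "sine_weight 0 / sine_weight 1 < 0" by (simp add: divide_neg_pos)
  then show "1 \<noteq> complex_of_real (sine_weight 0 / sine_weight 1)"
    by (metis of_real_eq_1_iff not_one_less_zero)
  show "cf_comp (\<lambda>i. of_real (bz i)) (p * k + h) (Some 0) =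
      Some (complex_of_real (sine_weight 0 / sine_weight 1))" for k
  proof -
    have "2 * real k + 1 \<noteq> 0" by linarith
    then have "closed_form 1 k h \<noteq> 0"
      "closed_form 0 k h / closed_form 1 k h = sine_weight 0 / sine_weight 1"
      using nz sin_theta_pos by (simp_all add: mid)
    then show ?thesis
      by (simp only: cf_comp_bz_zero scaled_eq_closed_form[OF h] if_False)
  qed
qed

lemma z_par_gt_1: "z_par p > 1"
  using cos_theta_pos cos_theta_sq_less_1 by (simp add: z_par_def)

end

section \<open>The case \<open>p = 3\<close> and the combined result\<close>

lemma z_par_3: "z_par 3 = 4"
  by (simp add: z_par_def cos_60 power2_eq_square)

theorem mainTheorem3:
  shows "(\<forall>p::nat. 3 \<le> p \<longrightarrow>
           z_par p > 1 \<and>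
           (\<lambda>i. b_coeff p i * z_par p) \<longlonglongrightarrow> z_par p / 4 \<and>
           z_par p / 4 > 1 / 4 \<and>
           (odd p \<longrightarrow>
              cf_converges_to (\<lambda>i. complex_of_real (b_coeff p i * z_par p)) (Some 1)) \<and>
           (even p \<longrightarrow>
              cf_diverges_by_oscillation (\<lambda>i. complex_of_real (b_coeff p i * z_par p))))
         \<and> z_par 3 = 4
         \<and> map (\<lambda>i. 4 * b_coeff 3 i) [1..<10] = [1, 3/2, 1, 1/3, 5/3, 1, 3/5, 7/5, 1]
         \<and> cf_converges_to (\<lambda>i. complex_of_real (4 * b_coeff 3 i)) (Some 1)"
proof (intro conjI allI impI)
  fix p :: nat
  assume p: "3 \<le> p"
  show z: "z_par p > 1" by (rule z_par_gt_1[OF p])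
  then show "z_par p / 4 > 1 / 4" by simp
  show "(\<lambda>i. b_coeff p i * z_par p) \<longlonglongrightarrow> z_par p / 4"
    using tendsto_mult_right[OF b_coeff_tendsto[of p], of "z_par p"] p by simp
  show "odd p \<Longrightarrow> cf_converges_to (\<lambda>i. complex_of_real (b_coeff p i * z_par p)) (Some 1)"
    by (rule odd_converges[OF p])
  show "even p \<Longrightarrow> cf_diverges_by_oscillation (\<lambda>i. complex_of_real (b_coeff p i * z_par p))"
    by (rule even_diverges[OF p])
next
  show "z_par 3 = 4" by (rule z_par_3)
  show "map (\<lambda>i. 4 * b_coeff 3 i) [1..<10] = [1, 3/2, 1, 1/3, 5/3, 1, 3/5, 7/5, 1]"
    by (simp add: upt_rec b_coeff_def)
  show "cf_converges_to (\<lambda>i. complex_of_real (4 * b_coeff 3 i)) (Some 1)"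
    using odd_converges[of 3] by (simp add: z_par_3 mult.commute)
qed

end
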